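(* Let $f,g$ be arbitrary functions, let $L_1<L_2$, and let $\{x\}=\{x_1,\dots,x_{L_1}\}$, $\{y\}=\{y_1,\dots,y_{L_2}\}$ be two arbitrary sets of parameters. Then $$\mathcal{A}_{\{x\}\cup\{y\}}[f,g]=\frac{\widehat V(x_1-\frac\eta2,\dots,x_{L_1}-\frac\eta2)}{\widehat V(x_1+\frac\eta2,\dots,x_{L_1}+\frac\eta2)}\;\frac{\det_{L_2}\widetilde{\mathcal{S}}_{\mathbf{x},\mathbf{y}}[f,g]}{\widehat V(x_{L_1},\dots,x_1)\,\widehat V(y_1,\dots,y_{L_2})},$$ where $\widetilde{\mathcal{S}}_{\mathbf{x},\mathbf{y}}[f,g]$ is the $L_2\times L_2$ matrix with entries, for $k\le L_1$, $$\big[\widetilde{\mathcal{S}}_{\mathbf{x},\mathbf{y}}[f,g]\big]_{i,k}=\sum_{\epsilon\in\{+,-\}}f(\epsilon y_i)X(y_i+\epsilon\eta)\Bigg[\frac{f(-x_k)}{\varsigma(y_i+\epsilon\frac\eta2)-\varsigma(x_k+\frac\eta2)}-\frac{f(x_k)\varphi_{\{x\}}(x_k)}{\varsigma(y_i+\epsilon\frac\eta2)-\varsigma(x_k-\frac\eta2)}\Bigg],$$ and, for $k>L_1$, $$\big[\widetilde{\mathcal{S}}_{\mathbf{x},\mathbf{y}}[f,g]\big]_{i,k}=\sum_{\epsilon\in\{+,-\}}f(\epsilon y_i)X(y_i+\epsilon\eta)\Bigg\{\varsigma(y_i+\epsilon\eta/2)^{k-L_1-1}-\delta_{k,L_2}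\sum_{j=1}^{L_1}\frac{X^g_{f,j}}{\varsigma(y_i+\epsilon\frac\eta2)-\varsigma(x_j-\frac\eta2)}\Bigg\}+\delta_{k,L_2}\frac{g(y_i)}{X(y_i)}.$$
   Context: $\eta\in\mathbb{C}$ is fixed, $\varsigma(\lambda)=\cosh(2\lambda)/2$, $\widehat V(z_1,\dots,z_n)=\prod_{j<k}(\sinh^2z_k-\sinh^2z_j)$. For variables $\{z_1,\dots,z_n\}$, $$\mathcal{A}_{\{z\}}[f,g]=\frac{\det_{1\le i,j\le n}\big[\sum_{\epsilon=\pm1}f(\epsilon z_i)\,\varsigma(z_i+\epsilon\eta/2)^{j-1}+\delta_{j,n}\,g(z_i)\big]}{\widehat V(z_1,\dots,z_n)}$$ (here $n=L_1+L_2$ and $(z_1,\dots,z_n)=(x_1,\dots,x_{L_1},y_1,\dots,y_{L_2})$). Moreover $$X(\lambda)=\prod_{\ell=1}^{L_1}[\varsigma(\lambda)-\varsigma(x_\ell)],\quad X_k(\lambda)=\prod_{\ell\ne k}[\varsigma(\lambda)-\varsigma(x_\ell)],\quad \varphi_{\{x\}}(\lambda)=\frac{\sinh(2\lambda-\eta)}{\sinh(2\lambda+\eta)}\frac{X(\lambda+\eta)}{X(\lambda-\eta)},$$ $$X^g_{f,k}=-\frac{g(x_k)}{f(-x_k)\sinh(2x_k)\sinh\eta\,X_k(x_k)X_k(x_k-\eta)}=\frac{g(x_k)\sinh(2x_k-\eta)}{f(-x_k)X'(x_k)X(x_k-\eta)}.$$ All parameters are assumed such that no denominator vanishes. *)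

theory Defs
  imports Complex_Main "Jordan_Normal_Form.Determinant"
begin

text \<open>
  Tuples of parameters are lists of complex numbers; the only order-sensitive uses are in
  \<open>Vhat\<close> and in the rows and columns of the determinants.  List positions and matrix indices
  start at 0, so an index \<open>i\<close> below is the index \<open>i + 1\<close> of the usual 1-based formulas.
\<close>

definition varsig :: "complex \<Rightarrow> complex" where
  "varsig t = cosh (2 * t) / 2"

definition Vhat :: "complex list \<Rightarrow> complex" where
  "Vhat zs = (\<Prod>k<length zs. \<Prod>j<k. (sinh (zs ! k))\<^sup>2 - (sinh (zs ! j))\<^sup>2)"

definition calA :: "complex \<Rightarrow> complex list \<Rightarrow> (complex \<Rightarrow> complex) \<Rightarrow> (complex \<Rightarrow> complex) \<Rightarrow> complex"
where
  "calA \<eta> zs f g =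
     (let n = length zs in
      Determinant.det (mat n n (\<lambda>(i, j).
        (\<Sum>\<epsilon>\<in>{1, -1}. f (\<epsilon> * zs ! i) * varsig (zs ! i + \<epsilon> * \<eta> / 2) ^ j)
        + (if j = n - 1 then g (zs ! i) else 0)))
      / Vhat zs)"

definition X :: "complex list \<Rightarrow> complex \<Rightarrow> complex" where
  "X xs t = (\<Prod>l<length xs. varsig t - varsig (xs ! l))"

definition X_omit :: "complex list \<Rightarrow> nat \<Rightarrow> complex \<Rightarrow> complex" where
  "X_omit xs k t = (\<Prod>l\<in>{..<length xs} - {k}. varsig t - varsig (xs ! l))"

definition phi :: "complex \<Rightarrow> complex list \<Rightarrow> complex \<Rightarrow> complex" where
  "phi \<eta> xs t = sinh (2 * t - \<eta>) / sinh (2 * t + \<eta>) * (X xs (t + \<eta>) / X xs (t - \<eta>))"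

definition Xg :: "complex \<Rightarrow> complex list \<Rightarrow> (complex \<Rightarrow> complex) \<Rightarrow> (complex \<Rightarrow> complex) \<Rightarrow> nat \<Rightarrow> complex"
where
  "Xg \<eta> xs f g k =
     - (g (xs ! k) /
        (f (- (xs ! k)) * sinh (2 * xs ! k) * sinh \<eta>
          * X_omit xs k (xs ! k) * X_omit xs k (xs ! k - \<eta>)))"

definition Stilde ::
  "complex \<Rightarrow> complex list \<Rightarrow> complex list \<Rightarrow> (complex \<Rightarrow> complex) \<Rightarrow> (complex \<Rightarrow> complex) \<Rightarrow> complex mat"
where
  "Stilde \<eta> xs ys f g =
     (let L1 = length xs; L2 = length ys in
      mat L2 L2 (\<lambda>(i, k).
        let y = ys ! i in
        if k < L1 then
          (\<Sum>\<epsilon>\<in>{1, -1}. f (\<epsilon> * y) * X xs (y + \<epsilon> * \<eta>) *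
             (f (- (xs ! k)) / (varsig (y + \<epsilon> * \<eta> / 2) - varsig (xs ! k + \<eta> / 2))
              - f (xs ! k) * phi \<eta> xs (xs ! k)
                / (varsig (y + \<epsilon> * \<eta> / 2) - varsig (xs ! k - \<eta> / 2))))
        else
          (\<Sum>\<epsilon>\<in>{1, -1}. f (\<epsilon> * y) * X xs (y + \<epsilon> * \<eta>) *
             (varsig (y + \<epsilon> * \<eta> / 2) ^ (k - L1)
              - (if k = L2 - 1 then
                   (\<Sum>j<L1. Xg \<eta> xs f g j
                      / (varsig (y + \<epsilon> * \<eta> / 2) - varsig (xs ! j - \<eta> / 2)))
                 else 0)))
          + (if k = L2 - 1 then g y / X xs y else 0)))"

end

(* Each row of the determinant on the left is a linear functional on polynomials of degree < L1 + L2: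
   p is sent to f(z) p(varsig(z + eta/2)) + f(-z) p(varsig(z - eta/2)) plus g(z) times the top
   coefficient of p, evaluated on the monomials.  Let P have the 2 L1 roots
   a_k = varsig(x_k + eta/2) and b_k = varsig(x_k - eta/2).  The identity
   P(varsig(y + e eta/2)) = X(y) X(y + e eta), e = 1 or -1, shows that X(y_i) times the (i,k) entry of
   Stilde is the functional at y_i applied to the polynomial P / (u - a_k), combined with
   P / (u - b_k) so as to be killed by all functionals at the x's (k < L1), or to a monic multiple of
   P corrected in the same way (k >= L1).  Completed by the P / (u - b_k), these polynomials form a
   basis in which the matrix is block triangular.  The basis change has the determinant of its first
   2 L1 columns, which is found by evaluating them at the b's and a's.  Using P / (u - b_k)
   rather than P / (u - a_k) avoids dividing by f(x_k), which may vanish. *)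
theory Submission
  imports Defs
begin

section \<open>Determinants and polynomial bases\<close>

lemma poly_eq_sum_coeff:
  fixes p :: "'a::comm_semiring_1 poly"
  assumes "degree p < n"
  shows "poly p x = (\<Sum>k<n. x ^ k * coeff p k)"
proof -
  have "poly p x = (\<Sum>k\<le>degree p. x ^ k * coeff p k)"
    by (simp add: poly_altdef mult.commute)
  also have "\<dots> = (\<Sum>k<n. x ^ k * coeff p k)"
    using assms by (intro sum.mono_neutral_left) (auto simp: coeff_eq_0)
  finally show ?thesis .
qed

text \<open>The moments \<open>M i k\<close> stay arbitrary because the rows to be treated are not
  plain evaluations: they also read a top coefficient.\<close>

lemma det_mult_coeff:
  fixes M :: "nat \<Rightarrow> nat \<Rightarrow> 'a::comm_ring_1"
  shows "det (mat n n (\<lambda>(i, j). \<Sum>k<n. M i k * coeff (p j) k)) =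
    det (mat n n (\<lambda>(i, j). M i j)) * det (mat n n (\<lambda>(k, j). coeff (p j) k))"
proof -
  have "mat n n (\<lambda>(i, j). \<Sum>k<n. M i k * coeff (p j) k) =
    mat n n (\<lambda>(i, j). M i j) * mat n n (\<lambda>(k, j). coeff (p j) k)"
    by (rule eq_matI) (auto simp: scalar_prod_def lessThan_atLeast0)
  then show ?thesis
    by (simp add: det_mult[of _ n])
qed

lemma det_poly_eval:
  fixes p :: "nat \<Rightarrow> 'a::comm_ring_1 poly"
  assumes "\<And>j. j < n \<Longrightarrow> degree (p j) < n"
  shows "det (mat n n (\<lambda>(i, j). poly (p j) (c i))) =
    det (mat n n (\<lambda>(i, j). c i ^ j)) * det (mat n n (\<lambda>(k, j). coeff (p j) k))"
proof -
  have "mat n n (\<lambda>(i, j). poly (p j) (c i)) =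
    mat n n (\<lambda>(i, j). \<Sum>k<n. c i ^ k * coeff (p j) k)"
    by (rule eq_matI) (auto simp: poly_eq_sum_coeff[OF assms])
  then show ?thesis
    by (simp only: det_mult_coeff)
qed

lemma det_upper_triangular_mat:
  fixes h :: "nat \<Rightarrow> nat \<Rightarrow> 'a::idom"
  assumes "\<And>i j. j < i \<Longrightarrow> i < n \<Longrightarrow> h i j = 0"
  shows "det (mat n n (\<lambda>(i, j). h i j)) = (\<Prod>i<n. h i i)"
  using assms by (subst det_upper_triangular[of _ n]) (auto simp: prod_list_diag_prod lessThan_atLeast0)

lemma det_lower_triangular_mat:
  fixes h :: "nat \<Rightarrow> nat \<Rightarrow> 'a::idom"
  assumes "\<And>i j. i < j \<Longrightarrow> j < n \<Longrightarrow> h i j = 0"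
  shows "det (mat n n (\<lambda>(i, j). h i j)) = (\<Prod>i<n. h i i)"
  using assms by (subst det_lower_triangular[of n]) (auto simp: prod_list_diag_prod lessThan_atLeast0)

lemma det_block_lower_triangular:
  fixes h :: "nat \<Rightarrow> nat \<Rightarrow> 'a::idom"
  assumes "\<And>i j. i < m \<Longrightarrow> j < n \<Longrightarrow> h i (m + j) = 0"
  shows "det (mat (m + n) (m + n) (\<lambda>(i, j). h i j)) =
    det (mat m m (\<lambda>(i, j). h i j)) * det (mat n n (\<lambda>(i, j). h (m + i) (m + j)))"
proof -
  have "mat (m + n) (m + n) (\<lambda>(i, j). h i j) =
    four_block_mat (mat m m (\<lambda>(i, j). h i j)) (0\<^sub>m m n)
      (mat n m (\<lambda>(i, j). h (m + i) j)) (mat n n (\<lambda>(i, j). h (m + i) (m + j)))"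
  proof (rule eq_matI, goal_cases)
    case (1 i j)
    then show ?case
      using assms[of i "j - m"] by auto
  qed auto
  then show ?thesis
    by (simp add: det_four_block_mat_upper_right_zero[of _ m _ n])
qed

lemma det_block_upper_triangular:
  fixes h :: "nat \<Rightarrow> nat \<Rightarrow> 'a::idom"
  assumes "\<And>i j. i < n \<Longrightarrow> j < m \<Longrightarrow> h (m + i) j = 0"
  shows "det (mat (m + n) (m + n) (\<lambda>(i, j). h i j)) =
    det (mat m m (\<lambda>(i, j). h i j)) * det (mat n n (\<lambda>(i, j). h (m + i) (m + j)))"
proof -
  have "mat (m + n) (m + n) (\<lambda>(i, j). h i j) =
    four_block_mat (mat m m (\<lambda>(i, j). h i j)) (mat m n (\<lambda>(i, j). h i (m + j)))
      (0\<^sub>m n m) (mat n n (\<lambda>(i, j). h (m + i) (m + j)))"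
  proof (rule eq_matI, goal_cases)
    case (1 i j)
    then show ?case
      using assms[of "i - m" j] by auto
  qed auto
  then show ?thesis
    by (simp add: det_four_block_mat_lower_left_zero[of _ m _ n])
qed

text \<open>Monicity makes the lower right block unitriangular. With \<open>m = 0\<close> this
  covers the Newton basis, with \<open>m = L + L\<close> the adapted basis.\<close>

lemma det_coeff_monic_tail:
  fixes p :: "nat \<Rightarrow> 'a::idom poly"
  assumes small: "\<And>j. j < m \<Longrightarrow> degree (p j) < m"
    and tail: "\<And>j. m \<le> j \<Longrightarrow> j < m + n \<Longrightarrow> degree (p j) = j \<and> lead_coeff (p j) = 1"
  shows "det (mat (m + n) (m + n) (\<lambda>(k, j). coeff (p j) k)) =
    det (mat m m (\<lambda>(k, j). coeff (p j) k))"
proof -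
  have "coeff (p j) (m + i) = 0" if "j < m" for i j
    using small[OF that] by (intro coeff_eq_0) auto
  then have "det (mat (m + n) (m + n) (\<lambda>(k, j). coeff (p j) k)) =
    det (mat m m (\<lambda>(k, j). coeff (p j) k)) *
    det (mat n n (\<lambda>(k, j). coeff (p (m + j)) (m + k)))"
    by (subst det_block_upper_triangular) auto
  also have "det (mat n n (\<lambda>(k, j). coeff (p (m + j)) (m + k))) = 1"
  proof (subst det_upper_triangular_mat)
    show "coeff (p (m + j)) (m + i) = 0" if "j < i" "i < n" for i j
      using that tail[of "m + j"] by (intro coeff_eq_0) auto
    have "coeff (p (m + i)) (m + i) = 1" if "i < n" for i
      using that tail[of "m + i"] by auto
    then show "(\<Prod>i<n. coeff (p (m + i)) (m + i)) = 1"
      by simp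
  qed
  finally show ?thesis by simp
qed

section \<open>Nodal polynomials and the Vandermonde determinant\<close>

definition nodal :: "(nat \<Rightarrow> 'a::idom) \<Rightarrow> nat set \<Rightarrow> 'a poly" where
  "nodal c A = (\<Prod>l\<in>A. [:- c l, 1:])"

lemma poly_nodal: "poly (nodal c A) u = (\<Prod>l\<in>A. u - c l)"
  by (simp add: nodal_def poly_prod)

lemma degree_nodal: "degree (nodal c A) = card A"
  unfolding nodal_def by (subst degree_prod_eq_sum_degree) auto

lemma lead_coeff_nodal: "lead_coeff (nodal c A) = 1"
  unfolding nodal_def by (simp add: lead_coeff_prod)

lemma nodal_nonzero: "nodal c A \<noteq> 0"
  using lead_coeff_nodal[of c A] by auto

definition vandermonde :: "(nat \<Rightarrow> 'a::comm_ring_1) \<Rightarrow> nat \<Rightarrow> 'a" where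
  "vandermonde c n = (\<Prod>k<n. \<Prod>j<k. c k - c j)"

text \<open>Passing to the Newton basis leaves the determinant unchanged and makes the matrix triangular.\<close>
lemma det_vandermonde:
  fixes c :: "nat \<Rightarrow> 'a::idom"
  shows "det (mat n n (\<lambda>(i, j). c i ^ j)) = vandermonde c n"
proof -
  let ?p = "\<lambda>j. nodal c {..<j}"
  have "det (mat n n (\<lambda>(k, j). coeff (?p j) k)) = 1"
    using det_coeff_monic_tail[of 0 ?p n] lead_coeff_nodal[of c "{..<_}"]
    by (simp add: degree_nodal det_dim_zero)
  \<comment> \<open>Lower triangular because \<open>c i\<close> is a root of every Newton polynomial
    of index above \<open>i\<close>.\<close>
  moreover have "det (mat n n (\<lambda>(i, j). poly (?p j) (c i))) = vandermonde c n"
    unfolding vandermonde_def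
    by (subst det_lower_triangular_mat) (auto simp: poly_nodal prod_zero_iff)
  ultimately show ?thesis
    by (subst (asm) det_poly_eval) (auto simp: degree_nodal)
qed

lemma vandermonde_nonzero_iff:
  fixes c :: "nat \<Rightarrow> 'a::idom"
  shows "vandermonde c n \<noteq> 0 \<longleftrightarrow> inj_on c {..<n}"
proof
  assume "vandermonde c n \<noteq> 0"
  then have "c k \<noteq> c j" if "j < k" "k < n" for j k
    using that by (auto simp: vandermonde_def)
  then show "inj_on c {..<n}"
    by (auto simp: linorder_inj_onI' intro!: linorder_inj_onI') (metis (no_types))
next
  assume "inj_on c {..<n}"
  then show "vandermonde c n \<noteq> 0"
    by (auto simp: vandermonde_def dest: inj_onD)
qed

section \<open>Splitting products over two blocks of nodes, and reversal signs\<close>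

lemma prod_lessThan_add:
  fixes m n :: nat
  shows "(\<Prod>j<m + n. h j) = (\<Prod>j<m. h j) * (\<Prod>j<n. h (m + j))"
  by (induction n) (auto simp: mult_ac)

lemma prod_omit_lower:
  fixes k L M :: nat
  assumes "k < L"
  shows "(\<Prod>l\<in>{..<L + M} - {k}. h l) = (\<Prod>l\<in>{..<L} - {k}. h l) * (\<Prod>l<M. h (L + l))"
proof -
  have "{..<L + M} - {k} = ({..<L} - {k}) \<union> (+) L ` {..<M}"
    using assms by (auto simp: lessThan_atLeast0 image_add_atLeastLessThan)
  then have "(\<Prod>l\<in>{..<L + M} - {k}. h l) = (\<Prod>l\<in>{..<L} - {k}. h l) * (\<Prod>l\<in>(+) L ` {..<M}. h l)"
    by (simp only:) (rule prod.union_disjoint, auto)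
  then show ?thesis
    by (simp add: prod.reindex)
qed

lemma prod_omit_upper:
  fixes k L M :: nat
  shows "(\<Prod>l\<in>{..<L + M} - {L + k}. h l) = (\<Prod>l<L. h l) * (\<Prod>l\<in>{..<M} - {k}. h (L + l))"
proof -
  have "{..<L + M} - {L + k} = {..<L} \<union> (+) L ` ({..<M} - {k})"
    by (auto simp: image_set_diff lessThan_atLeast0 image_add_atLeastLessThan)
  then have "(\<Prod>l\<in>{..<L + M} - {L + k}. h l) = (\<Prod>l<L. h l) * (\<Prod>l\<in>(+) L ` ({..<M} - {k}). h l)"
    by (simp only:) (rule prod.union_disjoint, auto)
  then show ?thesis
    by (simp add: prod.reindex)
qed

lemma vandermonde_add:
  "vandermonde c (m + n) =
    vandermonde c m * vandermonde (\<lambda>k. c (m + k)) n * (\<Prod>k<n. \<Prod>j<m. c (m + k) - c j)"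
proof (induction n)
  case (Suc n)
  have "(\<Prod>j<m + n. c (m + n) - c j) = (\<Prod>j<m. c (m + n) - c j) * (\<Prod>j<n. c (m + n) - c (m + j))"
    by (rule prod_lessThan_add)
  with Suc show ?case
    by (simp add: vandermonde_def mult_ac)
qed (simp add: vandermonde_def)

text \<open>The sign (-1)^(n(n-1)/2), kept as a product that gains one factor per induction
  step.\<close>

definition reversal_sign :: "nat \<Rightarrow> 'a::comm_ring_1" where
  "reversal_sign n = (\<Prod>k<n. (- 1) ^ k)"

lemma reversal_sign_nonzero: "reversal_sign n \<noteq> (0 :: 'a::idom)"
  by (simp add: reversal_sign_def)

text \<open>A discriminant: each pair of nodes contributes its difference twice, with opposite
  signs.\<close>

lemma prod_omit_eq_vandermonde:
  "(\<Prod>k<n. \<Prod>l\<in>{..<n} - {k}. c k - c l) = reversal_sign n * (vandermonde c n)\<^sup>2"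
proof (induction n)
  case (Suc n)
  have "(\<Prod>l\<in>{..<Suc n} - {k}. c k - c l) = (c k - c n) * (\<Prod>l\<in>{..<n} - {k}. c k - c l)"
    if "k < n" for k
  proof -
    have "{..<Suc n} - {k} = insert n ({..<n} - {k})" using that by auto
    then show ?thesis by simp
  qed
  then have "(\<Prod>k<n. \<Prod>l\<in>{..<Suc n} - {k}. c k - c l) =
    (\<Prod>k<n. c k - c n) * (\<Prod>k<n. \<Prod>l\<in>{..<n} - {k}. c k - c l)"
    by (simp add: prod.distrib)
  moreover have "(\<Prod>k<n. c k - c n) = (- 1) ^ n * (\<Prod>k<n. c n - c k)"
    using prod.distrib[of "\<lambda>k. - 1" "\<lambda>k. c n - c k" "{..<n}"] by simp
  moreover have "{..<Suc n} - {n} = {..<n}" by auto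
  ultimately show ?case
    by (simp add: Suc.IH reversal_sign_def vandermonde_def power2_eq_square mult_ac)
qed (simp add: reversal_sign_def vandermonde_def)

lemma vandermonde_reverse:
  "vandermonde (\<lambda>k. c (n - 1 - k)) n = reversal_sign n * vandermonde c n"
proof -
  have "vandermonde (\<lambda>k. c (n - 1 - k)) n =
    (\<Prod>(k, j)\<in>Sigma {..<n} lessThan. c (n - 1 - k) - c (n - 1 - j))"
    unfolding vandermonde_def by (simp add: prod.Sigma)
  \<comment> \<open>Reversing the indices and exchanging them keeps the pair decreasing, so the sign
    stays in each difference.\<close>
  also have "\<dots> = (\<Prod>(k, j)\<in>Sigma {..<n} lessThan. c j - c k)"
    by (rule prod.reindex_bij_witness[of _ "\<lambda>(k, j). (n - 1 - j, n - 1 - k)"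
          "\<lambda>(k, j). (n - 1 - j, n - 1 - k)"]) auto
  also have "\<dots> = reversal_sign n * vandermonde c n"
    unfolding vandermonde_def reversal_sign_def
    using prod.distrib[of "\<lambda>j. - 1" "\<lambda>j. c k - c j" "{..<k}" for k]
    by (simp add: prod.Sigma[symmetric] prod.distrib[symmetric])
  finally show ?thesis .
qed


section \<open>A polynomial basis killing the rows with index below L\<close>

text \<open>The nodes come in two halves of partners, \<open>c k\<close> = b_k and
  \<open>c (L + k)\<close> = a_k; \<open>m\<close> counts the rows that survive. The weights are
  free here, and \<open>det_reduction\<close> ties them to the rows. \<open>L < m\<close> puts the
  last column among the multiples of \<open>node_poly\<close>.\<close>

locale adapted_basis =
  fixes c :: "nat \<Rightarrow> 'a::field" and L m :: nat and \<alpha> \<beta> \<gamma> :: "nat \<Rightarrow> 'a"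
  assumes L_less: "L < m" and inj_c: "inj_on c {..<L + L}"
begin

definition node_poly :: "'a poly" where
  "node_poly = nodal c {..<L + L}"

definition omit_poly :: "nat \<Rightarrow> 'a poly" where
  "omit_poly k = nodal c ({..<L + L} - {k})"

text \<open>For \<open>k < L + L\<close> this is the derivative of \<open>node_poly\<close> at its
  root \<open>c k\<close>.\<close>

definition omit_val :: "nat \<Rightarrow> 'a" where
  "omit_val k = poly (omit_poly k) (c k)"

text \<open>The first \<open>L\<close> polynomials serve as pivots, each nonzero at a single b-node.
  The next \<open>L\<close> live on one a-node and its partner. The rest vanish at all nodes, except
  that the last one, whose top coefficient feeds the \<open>g\<close> term, is corrected at the
  b-nodes.\<close>

definition basis :: "nat \<Rightarrow> 'a poly" where
  "basis j =
     (if j < L then omit_poly j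
      else if j < L + L then smult (\<alpha> (j - L)) (omit_poly j) - smult (\<beta> (j - L)) (omit_poly (j - L))
      else node_poly * monom 1 (j - (L + L))
        - (if j = L + m - 1 then \<Sum>l<L. smult (\<gamma> l) (omit_poly l) else 0))"

section \<open>Node values and degrees of the basis\<close>

lemma omit_val_nonzero: "k < L + L \<Longrightarrow> omit_val k \<noteq> 0"
  using inj_c by (auto simp: omit_val_def omit_poly_def poly_nodal dest!: inj_onD)

text \<open>Factors are grouped by partner nodes because each such pair gets a closed form from the
  hyperbolic shift identity; the node's own partner is left over.\<close>

lemma omit_val_lower:
  assumes "k < L"
  shows "omit_val k =
    (\<Prod>l\<in>{..<L} - {k}. (c k - c l) * (c k - c (L + l))) * (c k - c (L + k))"
  using assms prod.remove[of "{..<L}" k "\<lambda>l. c k - c (L + l)"]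
  by (simp add: omit_val_def omit_poly_def poly_nodal prod_omit_lower prod.distrib mult_ac)

lemma omit_val_upper:
  assumes "k < L"
  shows "omit_val (L + k) =
    (\<Prod>l\<in>{..<L} - {k}. (c (L + k) - c l) * (c (L + k) - c (L + l))) * (c (L + k) - c k)"
  using assms prod.remove[of "{..<L}" k "\<lambda>l. c (L + k) - c l"]
  by (simp add: omit_val_def omit_poly_def poly_nodal prod_omit_upper prod.distrib mult_ac)

lemma omit_poly_node: "i < L + L \<Longrightarrow> poly (omit_poly k) (c i) = (if i = k then omit_val k else 0)"
  by (auto simp: omit_val_def omit_poly_def poly_nodal)

lemma node_poly_node: "i < L + L \<Longrightarrow> poly node_poly (c i) = 0"
  by (auto simp: node_poly_def poly_nodal)

lemma degree_omit_poly: "k < L + L \<Longrightarrow> degree (omit_poly k) < L + L"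
  by (simp add: omit_poly_def degree_nodal card_Diff_singleton_if)

lemma poly_omit_poly:
  assumes "k < L + L" "u \<noteq> c k"
  shows "poly (omit_poly k) u = poly node_poly u / (u - c k)"
proof -
  have "poly node_poly u = (u - c k) * poly (omit_poly k) u"
    using assms unfolding node_poly_def omit_poly_def poly_nodal
    by (subst prod.remove[of _ k]) auto
  with assms show ?thesis by simp
qed

lemma degree_basis_small:
  assumes "j < L + L"
  shows "degree (basis j) < L + L"
proof -
  have "degree (smult a (omit_poly k)) < L + L" if "k < L + L" for a k
    using degree_omit_poly[OF that] by (rule le_less_trans[OF degree_smult_le])
  then show ?thesis
    using assms by (auto simp: basis_def degree_omit_poly intro!: degree_diff_less)
qed

text \<open>The correction has degree below \<open>L + L\<close>, so it cannot disturb the leading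
  term.\<close>

lemma basis_tail:
  assumes "L + L \<le> j"
  shows "degree (basis j) = j \<and> lead_coeff (basis j) = 1"
proof -
  let ?p = "node_poly * monom 1 (j - (L + L))"
  let ?q = "if j = L + m - 1 then \<Sum>l<L. smult (\<gamma> l) (omit_poly l) else 0"
  have deg_p: "degree ?p = j"
    using assms nodal_nonzero[of c "{..<L + L}"] degree_monom_eq[of "1 :: 'a" "j - (L + L)"]
    by (simp add: degree_mult_eq node_poly_def degree_nodal monom_eq_0_iff)
  have lead_p: "lead_coeff ?p = 1"
    by (simp add: lead_coeff_mult node_poly_def lead_coeff_nodal degree_monom_eq)
  have coeff_q: "coeff ?q i = 0" if "j \<le> i" for i
  proof -
    have "coeff (omit_poly l) i = 0" if "l < L" for l
      using degree_omit_poly[of l] that \<open>j \<le> i\<close> assms by (intro coeff_eq_0) auto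
    then show ?thesis by (simp add: coeff_sum)
  qed
  have eq: "basis j = ?p - ?q"
    using assms by (simp add: basis_def)
  have cj: "coeff (basis j) j = 1"
    using lead_p coeff_q[of j] unfolding eq coeff_diff deg_p by simp
  have "degree (basis j) \<le> j"
  proof (rule degree_le, intro allI impI)
    fix i assume "j < i"
    then show "coeff (basis j) i = 0"
      using coeff_q[of i] deg_p unfolding eq coeff_diff by (simp add: coeff_eq_0)
  qed
  moreover have "j \<le> degree (basis j)"
    using cj by (intro le_degree) simp
  ultimately have "degree (basis j) = j" by simp
  with cj show ?thesis by simp
qed

lemma degree_basis: "j < L + m \<Longrightarrow> degree (basis j) < L + m"
  using degree_basis_small[of j] basis_tail[of j] L_less by (cases "j < L + L") auto

text \<open>Each row pairs \<open>g\<close> with this coefficient, so \<open>g\<close> enters the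
  last column only.\<close>

lemma coeff_basis_top:
  assumes "j < L + m"
  shows "coeff (basis j) (L + m - 1) = (if j = L + m - 1 then 1 else 0)"
proof (cases "j < L + L")
  case True
  then show ?thesis
    using degree_basis_small[of j] L_less by (auto intro!: coeff_eq_0)
next
  case False
  then show ?thesis
    using basis_tail[of j] assms by (auto intro!: coeff_eq_0)
qed

lemma basis_node:
  assumes "i < L + L"
  shows "poly (basis j) (c i) =
    (if j < L then if i = j then omit_val j else 0
     else if j < L + L then
       \<alpha> (j - L) * (if i = j then omit_val j else 0) - \<beta> (j - L) * (if i = j - L then omit_val i else 0)
     else if j = L + m - 1 \<and> i < L then - \<gamma> i * omit_val i else 0)"
  using assms
  by (auto simp: basis_def omit_poly_node node_poly_node poly_sum if_distrib[of "times _"] cong: if_cong)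

lemma prod_omit_val_upper:
  "(\<Prod>k<L. omit_val (L + k)) =
    (\<Prod>k<L. \<Prod>j<L. c (L + k) - c j) * (reversal_sign L * (vandermonde (\<lambda>k. c (L + k)) L)\<^sup>2)"
proof -
  have "omit_val (L + k) =
    (\<Prod>j<L. c (L + k) - c j) * (\<Prod>l\<in>{..<L} - {k}. c (L + k) - c (L + l))" if "k < L" for k
    by (simp add: omit_val_def omit_poly_def poly_nodal prod_omit_upper)
  then show ?thesis
    by (simp add: prod.distrib prod_omit_eq_vandermonde[of "\<lambda>k. c (L + k)"])
qed

text \<open>Evaluating the first \<open>2 L\<close> basis elements at the nodes gives a triangular matrix.\<close>
lemma det_basis:
  "vandermonde c L * det (mat (L + m) (L + m) (\<lambda>(k, j). coeff (basis j) k)) =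
    (\<Prod>k<L. omit_val k) * (\<Prod>k<L. \<alpha> k) * (reversal_sign L * vandermonde (\<lambda>k. c (L + k)) L)"
proof -
  define C where "C = det (mat (L + L) (L + L) (\<lambda>(k, j). coeff (basis j) k))"
  have C: "det (mat (L + m) (L + m) (\<lambda>(k, j). coeff (basis j) k)) = C"
    using det_coeff_monic_tail[OF degree_basis_small basis_tail, of "m - L"] L_less
    by (simp add: C_def add.assoc)
  let ?a = "\<lambda>k. c (L + k)" and ?E = "\<Prod>k<L. \<Prod>j<L. c (L + k) - c j"
  have "vandermonde c (L + L) * C = det (mat (L + L) (L + L) (\<lambda>(i, j). poly (basis j) (c i)))"
    unfolding C_def by (simp add: det_poly_eval[OF degree_basis_small] det_vandermonde)
  also have "\<dots> = (\<Prod>i<L + L. poly (basis i) (c i))"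
    by (rule det_upper_triangular_mat) (auto simp: basis_node)
  also have "\<dots> = (\<Prod>k<L. omit_val k) * ((\<Prod>k<L. \<alpha> k) * (\<Prod>k<L. omit_val (L + k)))"
    unfolding prod_lessThan_add by (auto simp: basis_node prod.distrib)
  finally have *: "vandermonde c (L + L) * C = \<dots>" .
  \<comment> \<open>\<open>vandermonde c (L + L)\<close> is the product of both half Vandermondes
    and \<open>?E\<close>, while the values at the a-nodes give \<open>?E\<close> times a square;
    \<open>?E\<close> and one Vandermonde of the a-nodes cancel.\<close>
  have "vandermonde c (L + L) \<noteq> 0"
    using inj_c by (simp add: vandermonde_nonzero_iff)
  then have "?E \<noteq> 0" "vandermonde ?a L \<noteq> 0"
    unfolding vandermonde_add by auto
  moreover have "(?E * vandermonde ?a L) * (vandermonde c L * C) = (?E * vandermonde ?a L) *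
    ((\<Prod>k<L. omit_val k) * (\<Prod>k<L. \<alpha> k) * (reversal_sign L * vandermonde ?a L))"
    using * unfolding vandermonde_add prod_omit_val_upper by (simp only: power2_eq_square mult_ac)
  ultimately show ?thesis
    unfolding C by simp
qed

section \<open>Reduction to the rows beyond the first \<open>L\<close>\<close>

definition column_factor :: "nat \<Rightarrow> 'a \<Rightarrow> 'a" where
  "column_factor k u =
     (if k < L then \<alpha> k / (u - c (L + k)) - \<beta> k / (u - c k)
      else u ^ (k - L) - (if k = m - 1 then \<Sum>l<L. \<gamma> l / (u - c l) else 0))"

text \<open>Dividing out \<open>node_poly\<close> turns omitted nodes into the simple fractions in
  the brackets of \<open>Stilde\<close>.\<close>

lemma poly_basis_column_factor:
  assumes "k < m" "\<And>l. l < L + L \<Longrightarrow> u \<noteq> c l"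
  shows "poly (basis (L + k)) u = poly node_poly u * column_factor k u"
proof (cases "k < L")
  case True
  then show ?thesis
    using assms by (simp add: basis_def column_factor_def poly_omit_poly right_diff_distrib mult_ac)
next
  case False
  have "(\<Sum>l<L. \<gamma> l * poly (omit_poly l) u) = (\<Sum>l<L. \<gamma> l * (poly node_poly u / (u - c l)))"
    using assms by (intro sum.cong) (auto simp: poly_omit_poly)
  also have "\<dots> = poly node_poly u * (\<Sum>l<L. \<gamma> l / (u - c l))"
    by (simp add: sum_distrib_left mult_ac)
  finally have "(\<Sum>l<L. \<gamma> l * poly (omit_poly l) u) = \<dots>" .
  moreover have "L + k = L + m - 1 \<longleftrightarrow> k = m - 1"
    using assms(1) by auto
  ultimately show ?thesis
    using False by (auto simp: basis_def column_factor_def poly_sum poly_monom right_diff_distrib)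
qed

lemma row_functional:
  assumes "j < L + m"
  shows "(\<Sum>k<L + m. (s * u ^ k + t * v ^ k + (if k = L + m - 1 then w else 0)) * coeff (basis j) k) =
    s * poly (basis j) u + t * poly (basis j) v + w * (if j = L + m - 1 then 1 else 0)"
proof -
  have "(\<Sum>k<L + m. (if k = L + m - 1 then w else 0) * coeff (basis j) k) =
      (\<Sum>k<L + m. if k = L + m - 1 then w * coeff (basis j) k else 0)"
    by (intro sum.cong) auto
  also have "\<dots> = w * coeff (basis j) (L + m - 1)"
    using assms by simp
  finally show ?thesis
    using degree_basis[OF assms]
    by (simp only: distrib_right sum.distrib poly_eq_sum_coeff sum_distrib_left mult.assoc coeff_basis_top[OF assms])
qed

text \<open>
  In the adapted basis the first \<open>L\<close> rows vanish outside their first \<open>L\<close> columns, where they are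
  diagonal, so the determinant reduces to the remaining \<open>m\<close> rows.
\<close>
theorem det_reduction:
  assumes alpha: "\<And>k. k < L \<Longrightarrow> \<alpha> k \<noteq> 0"
    and rows: "\<And>i. i < L \<Longrightarrow> u i = c (L + i)" "\<And>i. i < L \<Longrightarrow> v i = c i" "\<And>i. i < L \<Longrightarrow> t i = \<alpha> i"
    and beta: "\<And>i. i < L \<Longrightarrow> \<beta> i * omit_val i = s i * omit_val (L + i)"
    and gamma: "\<And>i. i < L \<Longrightarrow> \<gamma> i * \<alpha> i * omit_val i = w i"
    and off: "\<And>i l. i < m \<Longrightarrow> l < L + L \<Longrightarrow> u (L + i) \<noteq> c l"
      "\<And>i l. i < m \<Longrightarrow> l < L + L \<Longrightarrow> v (L + i) \<noteq> c l"
    and split: "\<And>i. i < m \<Longrightarrow> poly node_poly (u (L + i)) = r i * p i"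
      "\<And>i. i < m \<Longrightarrow> poly node_poly (v (L + i)) = r i * q i"
    and r: "\<And>i. i < m \<Longrightarrow> r i \<noteq> 0"
  shows "reversal_sign L * vandermonde (\<lambda>k. c (L + k)) L *
      det (mat (L + m) (L + m) (\<lambda>(i, j). s i * u i ^ j + t i * v i ^ j + (if j = L + m - 1 then w i else 0))) =
    vandermonde c L * (\<Prod>i<m. r i) *
      det (mat m m (\<lambda>(i, k). s (L + i) * p i * column_factor k (u (L + i)) + t (L + i) * q i * column_factor k (v (L + i))
        + (if k = m - 1 then w (L + i) / r i else 0)))"
    (is "?\<rho> * det ?M = ?V * ?R * det ?S")
proof -
  define h where "h i j = s i * poly (basis j) (u i) + t i * poly (basis j) (v i)
    + w i * (if j = L + m - 1 then 1 else 0)" for i j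
  let ?C = "mat (L + m) (L + m) (\<lambda>(k, j). coeff (basis j) k)"
  let ?A = "\<Prod>k<L. \<alpha> k" and ?O = "\<Prod>k<L. omit_val k"
  have "det ?M * det ?C = det (mat (L + m) (L + m) (\<lambda>(i, j). h i j))"
  proof -
    have "mat (L + m) (L + m) (\<lambda>(i, j). h i j) = mat (L + m) (L + m) (\<lambda>(i, j). \<Sum>k<L + m.
        (s i * u i ^ k + t i * v i ^ k + (if k = L + m - 1 then w i else 0)) * coeff (basis j) k)"
      by (rule eq_matI) (simp_all only: row_functional h_def dim_row_mat dim_col_mat index_mat prod.case)
    then show ?thesis by (simp only: det_mult_coeff)
  qed
  also have "\<dots> = det (mat L L (\<lambda>(i, j). h i j)) * det (mat m m (\<lambda>(i, j). h (L + i) (L + j)))"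
  proof (rule det_block_lower_triangular)
    fix i k assume ik: "i < L" "k < m"
    show "h i (L + k) = 0"
    proof (cases "k < L")
      case True
      \<comment> \<open>No \<open>g\<close> term here. Only partners of index \<open>i\<close>
        contribute, and as \<open>t i = \<alpha> i\<close> the entry is \<open>\<alpha> i\<close>
        times the difference of the two sides of \<open>beta\<close>.\<close>
      then have "L + k \<noteq> L + m - 1" using L_less by auto
      with True ik show ?thesis
        using beta[of i] by (auto simp: h_def rows basis_node algebra_simps)
    next
      case False
      \<comment> \<open>In the last column the correction at b_i cancels \<open>w i\<close> by
        \<open>gamma\<close>; the other tail polynomials vanish at both nodes.\<close>
      with ik show ?thesis
        using gamma[of i] by (auto simp: h_def rows basis_node algebra_simps)
    qed
  qed
  also have "det (mat L L (\<lambda>(i, j). h i j)) = ?A * ?O"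
  proof (subst det_upper_triangular_mat)
    show "h i j = 0" if "j < i" "i < L" for i j
      using that L_less by (auto simp: h_def rows basis_node)
    have "h i i = \<alpha> i * omit_val i" if "i < L" for i
      using that L_less by (auto simp: h_def rows basis_node)
    then show "(\<Prod>i<L. h i i) = ?A * ?O"
      by (simp add: prod.distrib)
  qed
  also have "det (mat m m (\<lambda>(i, j). h (L + i) (L + j))) = ?R * det ?S"
  proof -
    have "h (L + i) (L + k) = r i * ?S $$ (i, k)" if "i < m" "k < m" for i k
    proof -
      have "L + k = L + m - 1 \<longleftrightarrow> k = m - 1" using that by auto
      then show ?thesis
        using that r[of i] by (simp add: h_def poly_basis_column_factor off split algebra_simps)
    qed
    then have "mat m m (\<lambda>(i, j). h (L + i) (L + j)) = mat m m (\<lambda>(i, j). if i = j then r i else 0) * ?S"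
      by (intro eq_matI) (auto simp: scalar_prod_def if_distrib[of "\<lambda>x. x * _"] cong: if_cong)
    moreover have "det (mat m m (\<lambda>(i, j). if i = j then r i else 0)) = ?R"
      by (subst det_upper_triangular_mat) auto
    ultimately show ?thesis
      by (simp add: det_mult[of _ m])
  qed
  finally have "det ?M * (?V * det ?C) = ?A * ?O * (?V * ?R * det ?S)"
    by (simp only: mult_ac)
  \<comment> \<open>The pivots \<open>?A * ?O\<close> reappear in \<open>det_basis\<close>, so they
    drop out.\<close>
  then have "(?A * ?O) * (?\<rho> * det ?M) = (?A * ?O) * (?V * ?R * det ?S)"
    by (simp only: det_basis mult_ac)
  moreover have "?A * ?O \<noteq> 0"
    using alpha omit_val_nonzero by auto
  ultimately show ?thesis
    unfolding mult_cancel_left by blast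
qed

end


section \<open>Hyperbolic identities\<close>

lemma sinh_square_diff: "(sinh a)\<^sup>2 - (sinh b)\<^sup>2 = varsig a - varsig b"
  using cosh_double_cosh[of a] cosh_double_cosh[of b]
  by (simp add: varsig_def cosh_square_eq add_divide_distrib)

lemma varsig_diff: "varsig a - varsig b = sinh (a + b) * sinh (a - b)"
proof -
  have "sinh (a + b) * sinh (a - b) = (sinh a)\<^sup>2 * (cosh b)\<^sup>2 - (cosh a)\<^sup>2 * (sinh b)\<^sup>2"
    by (simp add: sinh_add sinh_diff power2_eq_square algebra_simps)
  also have "\<dots> = (sinh a)\<^sup>2 - (sinh b)\<^sup>2"
    by (simp add: cosh_square_eq algebra_simps)
  finally show ?thesis
    by (simp only: sinh_square_diff)
qed

text \<open>Both sides are the four factors sinh(y + e + x), sinh(y + e - x), sinh(y + x), sinh(y -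
  x), paired differently.\<close>

lemma varsig_shift_mult:
  "(varsig (y + e) - varsig x) * (varsig y - varsig x) =
    (varsig (y + e / 2) - varsig (x + e / 2)) * (varsig (y + e / 2) - varsig (x - e / 2))"
proof -
  have "y + e / 2 + (x + e / 2) = y + e + x" "y + e / 2 - (x + e / 2) = y - x"
    "y + e / 2 + (x - e / 2) = y + x" "y + e / 2 - (x - e / 2) = y + e - x"
    by (simp_all add: field_simps)
  then show ?thesis
    by (simp only: varsig_diff mult_ac)
qed

lemma varsig_shift_mult_minus:
  "(varsig (y - e) - varsig x) * (varsig y - varsig x) =
    (varsig (y - e / 2) - varsig (x - e / 2)) * (varsig (y - e / 2) - varsig (x + e / 2))"
  using varsig_shift_mult[of y "- e" x] by simp

lemma Vhat_eq_vandermonde: "Vhat zs = vandermonde (\<lambda>k. varsig (zs ! k)) (length zs)"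
  by (simp add: Vhat_def vandermonde_def sinh_square_diff)

lemma Vhat_map: "Vhat (map h zs) = vandermonde (\<lambda>k. varsig (h (zs ! k))) (length zs)"
  by (simp add: Vhat_eq_vandermonde vandermonde_def)

text \<open>The cross differences between the lists form values of \<open>X\<close>, which later
  cancel the scalars pulled out of the rows.\<close>

lemma Vhat_append: "Vhat (xs @ ys) = Vhat xs * Vhat ys * (\<Prod>i<length ys. X xs (ys ! i))"
proof -
  have "vandermonde (\<lambda>k. varsig ((xs @ ys) ! k)) (length xs) = Vhat xs"
    by (simp add: Vhat_eq_vandermonde vandermonde_def nth_append)
  then show ?thesis
    by (simp add: Vhat_eq_vandermonde[of "xs @ ys"] vandermonde_add)
      (simp add: Vhat_eq_vandermonde X_def nth_append)
qed

lemma Vhat_rev: "Vhat (rev xs) = reversal_sign (length xs) * Vhat xs"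
proof -
  have "Vhat (rev xs) = vandermonde (\<lambda>k. varsig (xs ! (length xs - 1 - k))) (length xs)"
    by (simp add: Vhat_eq_vandermonde vandermonde_def rev_nth)
  then show ?thesis
    by (simp only: vandermonde_reverse[of "\<lambda>k. varsig (xs ! k)"] Vhat_eq_vandermonde)
qed

lemma X_eq_X_omit:
  assumes "k < length xs"
  shows "X xs t = (varsig t - varsig (xs ! k)) * X_omit xs k t"
  using assms unfolding X_def X_omit_def by (subst prod.remove[of _ k]) auto

section \<open>Specialization to the shifted parameters\<close>

theorem mainTheorem11:
  fixes \<eta> :: complex
    and f g :: "complex \<Rightarrow> complex"
    and xs ys :: "complex list"
    and L1 L2 :: nat
  assumes "length xs = L1" and "length ys = L2" and "L1 < L2"
    and "Vhat (xs @ ys) \<noteq> 0"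
    and "Vhat (map (\<lambda>x. x + \<eta> / 2) xs) \<noteq> 0"
    and "Vhat (rev xs) \<noteq> 0"
    and "Vhat ys \<noteq> 0"
    and "\<And>y x \<epsilon>. y \<in> set ys \<Longrightarrow> x \<in> set xs \<Longrightarrow> \<epsilon> \<in> {1, -1} \<Longrightarrow>
           varsig (y + \<epsilon> * \<eta> / 2) - varsig (x + \<eta> / 2) \<noteq> 0"
    and "\<And>y x \<epsilon>. y \<in> set ys \<Longrightarrow> x \<in> set xs \<Longrightarrow> \<epsilon> \<in> {1, -1} \<Longrightarrow>
           varsig (y + \<epsilon> * \<eta> / 2) - varsig (x - \<eta> / 2) \<noteq> 0"
    and "\<And>x. x \<in> set xs \<Longrightarrow> sinh (2 * x + \<eta>) \<noteq> 0"
    and "\<And>x. x \<in> set xs \<Longrightarrow> X xs (x - \<eta>) \<noteq> 0"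
    and "\<And>y. y \<in> set ys \<Longrightarrow> X xs y \<noteq> 0"
    and "\<And>k. k < L1 \<Longrightarrow>
           f (- (xs ! k)) * sinh (2 * xs ! k) * sinh \<eta>
             * X_omit xs k (xs ! k) * X_omit xs k (xs ! k - \<eta>) \<noteq> 0"
  shows "calA \<eta> (xs @ ys) f g =
           Vhat (map (\<lambda>x. x - \<eta> / 2) xs) / Vhat (map (\<lambda>x. x + \<eta> / 2) xs)
           * (Determinant.det (Stilde \<eta> xs ys f g) / (Vhat (rev xs) * Vhat ys))"
proof -
  define c where "c k = (if k < L1 then varsig (xs ! k - \<eta> / 2) else varsig (xs ! (k - L1) + \<eta> / 2))" for k
  have c_lower: "c k = varsig (xs ! k - \<eta> / 2)" if "k < L1" for k
    using that by (simp add: c_def)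
  have c_upper: "c (L1 + k) = varsig (xs ! k + \<eta> / 2)" for k
    by (simp add: c_def)
  have c_gap: "c (L1 + k) - c k = sinh (2 * xs ! k) * sinh \<eta>" if "k < L1" for k
    unfolding c_lower[OF that] c_upper varsig_diff by simp
  \<comment> \<open>The shift identity at y = x_k; over \<open>l\<close> other than \<open>k\<close>
    these products give the two \<open>X_omit\<close> factors.\<close>
  have lower: "(c k - c l) * (c k - c (L1 + l)) =
      (varsig (xs ! k) - varsig (xs ! l)) * (varsig (xs ! k - \<eta>) - varsig (xs ! l))"
    if "k < L1" "l < L1" for k l
    using varsig_shift_mult_minus[of "xs ! k" \<eta> "xs ! l"] that by (simp add: c_lower c_upper mult_ac)
  have upper: "(c (L1 + k) - c l) * (c (L1 + k) - c (L1 + l)) =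
      (varsig (xs ! k) - varsig (xs ! l)) * (varsig (xs ! k + \<eta>) - varsig (xs ! l))"
    if "l < L1" for k l
    using varsig_shift_mult[of "xs ! k" \<eta> "xs ! l"] that by (simp add: c_lower c_upper mult_ac)
  have nz: "f (- (xs ! k)) \<noteq> 0" "sinh (2 * xs ! k) \<noteq> 0" "sinh \<eta> \<noteq> 0"
      "X_omit xs k (xs ! k) \<noteq> 0" "X_omit xs k (xs ! k - \<eta>) \<noteq> 0"
    if "k < L1" for k
    using assms(13)[OF that] by auto
  have lower_nz: "c k \<noteq> c l" "c k \<noteq> c (L1 + l)" if "k < L1" "l < L1" "k \<noteq> l" for k l
  proof -
    have "varsig (xs ! k) - varsig (xs ! l) \<noteq> 0" "varsig (xs ! k - \<eta>) - varsig (xs ! l) \<noteq> 0"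
      using nz(4,5)[OF that(1)] that assms(1) by (auto simp: X_omit_def)
    then show "c k \<noteq> c l" "c k \<noteq> c (L1 + l)"
      using lower[OF that(1,2)] by auto
  qed
  have gap_nz: "c k \<noteq> c (L1 + k)" if "k < L1" for k
    using c_gap[OF that] nz[OF that] by auto
  have upper_vandermonde: "vandermonde (\<lambda>k. c (L1 + k)) L1 = Vhat (map (\<lambda>x. x + \<eta> / 2) xs)"
    unfolding Vhat_map c_upper assms(1) by simp
  have upper_inj: "inj_on (\<lambda>k. c (L1 + k)) {..<L1}"
    using assms(5) unfolding upper_vandermonde[symmetric] vandermonde_nonzero_iff .
  \<comment> \<open>Pairs involving a b-node are separated by the nonzero denominators of
    \<open>Xg\<close>, pairs of a-nodes by the nonzero \<open>Vhat\<close> at x + eta/2.\<close>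
  have "inj_on c {..<L1 + L1}"
  proof (rule linorder_inj_onI')
    fix i j assume "i \<in> {..<L1 + L1}" "j \<in> {..<L1 + L1}" "i < j"
    then consider "j < L1" | j' where "i < L1" "j = L1 + j'" "j' < L1"
      | i' j' where "i = L1 + i'" "j = L1 + j'" "i' < j'" "j' < L1"
      using that(2)[of "j - L1"] that(3)[of "i - L1" "j - L1"]
      by (cases "j < L1"; cases "i < L1") auto
    then show "c i \<noteq> c j"
    proof cases
      case 1
      with \<open>i < j\<close> show ?thesis by (intro lower_nz) auto
    next
      case 2
      then show ?thesis using lower_nz(2)[of i j'] gap_nz[of i] by (cases "i = j'") auto
    next
      case 3
      then show ?thesis using inj_onD[OF upper_inj, of i' j'] by auto
    qed
  qed
  \<comment> \<open>\<open>\<alpha>\<close> is the weight of b_k in the row of x_k, nonzero as a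
    factor of the denominator of \<open>Xg\<close>.\<close>
  with assms(3) interpret adapted_basis c L1 L2 "\<lambda>k. f (- (xs ! k))"
      "\<lambda>k. f (xs ! k) * phi \<eta> xs (xs ! k)" "Xg \<eta> xs f g"
    by unfold_locales
  have omit_lower: "omit_val k =
      - (X_omit xs k (xs ! k) * X_omit xs k (xs ! k - \<eta>) * (sinh (2 * xs ! k) * sinh \<eta>))" if "k < L1" for k
  proof -
    have "(\<Prod>l\<in>{..<L1} - {k}. (c k - c l) * (c k - c (L1 + l))) =
        X_omit xs k (xs ! k) * X_omit xs k (xs ! k - \<eta>)"
      using that by (simp add: lower X_omit_def assms(1) prod.distrib)
    moreover have "c k - c (L1 + k) = - (sinh (2 * xs ! k) * sinh \<eta>)"
      using c_gap[OF that] by (simp add: algebra_simps)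
    ultimately show ?thesis
      by (simp add: omit_val_lower[OF that])
  qed
  have omit_upper: "omit_val (L1 + k) =
      X_omit xs k (xs ! k) * X_omit xs k (xs ! k + \<eta>) * (sinh (2 * xs ! k) * sinh \<eta>)" if "k < L1" for k
  proof -
    have "(\<Prod>l\<in>{..<L1} - {k}. (c (L1 + k) - c l) * (c (L1 + k) - c (L1 + l))) =
        X_omit xs k (xs ! k) * X_omit xs k (xs ! k + \<eta>)"
      using that by (simp add: upper X_omit_def assms(1) prod.distrib)
    then show ?thesis
      by (simp add: omit_val_upper[OF that] c_gap[OF that])
  qed
  \<comment> \<open>So \<open>phi\<close> is a ratio of derivatives of the nodal polynomial at
    partner nodes: its sinh prefactor removes, up to sign, the factors of index \<open>k\<close>
    from both values of \<open>X\<close>.\<close>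
  have phi: "phi \<eta> xs (xs ! k) * omit_val k = omit_val (L1 + k)" if "k < L1" for k
  proof -
    let ?x = "xs ! k"
    have "varsig (?x + \<eta>) - varsig ?x = sinh (2 * ?x + \<eta>) * sinh \<eta>"
      unfolding varsig_diff by (simp add: algebra_simps)
    then have plus: "X xs (?x + \<eta>) = sinh (2 * ?x + \<eta>) * sinh \<eta> * X_omit xs k (?x + \<eta>)"
      using X_eq_X_omit[of k xs "?x + \<eta>"] that assms(1) by simp
    have "varsig (?x - \<eta>) - varsig ?x = - (sinh (2 * ?x - \<eta>) * sinh \<eta>)"
      unfolding varsig_diff by (simp add: algebra_simps)
    then have minus: "X xs (?x - \<eta>) = - (sinh (2 * ?x - \<eta>) * sinh \<eta> * X_omit xs k (?x - \<eta>))"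
      using X_eq_X_omit[of k xs "?x - \<eta>"] that assms(1) by simp
    have "sinh (2 * ?x + \<eta>) \<noteq> 0" "X xs (?x - \<eta>) \<noteq> 0"
      using assms(10)[of ?x] assms(11)[of ?x] that assms(1) by auto
    moreover from this have "sinh (2 * ?x - \<eta>) \<noteq> 0"
      unfolding minus by auto
    ultimately show ?thesis
      using nz[OF that]
      by (simp add: phi_def plus minus omit_lower[OF that] omit_upper[OF that] divide_simps)
  qed
  \<comment> \<open>The denominator of \<open>Xg\<close> is minus \<open>f (- (xs ! k))\<close>
    times the derivative at b_k.\<close>
  have gamma: "Xg \<eta> xs f g k * f (- (xs ! k)) * omit_val k = g (xs ! k)" if "k < L1" for k
    using nz[OF that] by (simp add: Xg_def omit_lower[OF that] divide_simps)
  \<comment> \<open>The factors of partners b_l and a_l become the factors of index \<open>l\<close>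
    in the two values of \<open>X\<close>.\<close>
  have node_plus: "poly node_poly (varsig (y + \<eta> / 2)) = X xs y * X xs (y + \<eta>)" for y
    unfolding node_poly_def poly_nodal prod_lessThan_add X_def assms(1) prod.distrib[symmetric] c_upper
    by (intro prod.cong refl) (use varsig_shift_mult[of y \<eta>] in \<open>simp add: c_lower mult_ac\<close>)
  have node_minus: "poly node_poly (varsig (y - \<eta> / 2)) = X xs y * X xs (y - \<eta>)" for y
    unfolding node_poly_def poly_nodal prod_lessThan_add X_def assms(1) prod.distrib[symmetric] c_upper
    by (intro prod.cong refl) (use varsig_shift_mult_minus[of y \<eta>] in \<open>simp add: c_lower mult_ac\<close>)
  have off: "varsig (ys ! i + \<eta> / 2) \<noteq> c l" "varsig (ys ! i - \<eta> / 2) \<noteq> c l" if "i < L2" "l < L1 + L1" for i l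
  proof -
    have "ys ! i \<in> set ys" "l < L1 \<Longrightarrow> xs ! l \<in> set xs" "\<not> l < L1 \<Longrightarrow> xs ! (l - L1) \<in> set xs"
      using that assms(1,2) by auto
    then show "varsig (ys ! i + \<eta> / 2) \<noteq> c l" "varsig (ys ! i - \<eta> / 2) \<noteq> c l"
      using assms(8,9)[of "ys ! i" _ 1] assms(8,9)[of "ys ! i" _ "- 1"] by (auto simp: c_def)
  qed
  let ?z = "\<lambda>i. (xs @ ys) ! i"
  have z_lower: "?z i = xs ! i" if "i < L1" for i
    using that by (simp add: assms(1) nth_append)
  have z_upper: "?z (L1 + i) = ys ! i" for i
    by (simp add: nth_append flip: assms(1))
  define M where "M = mat (L1 + L2) (L1 + L2) (\<lambda>(i, j). f (?z i) * varsig (?z i + \<eta> / 2) ^ j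
    + f (- ?z i) * varsig (?z i - \<eta> / 2) ^ j + (if j = L1 + L2 - 1 then g (?z i) else 0))"
  have calA: "calA \<eta> (xs @ ys) f g = det M / Vhat (xs @ ys)"
    unfolding calA_def M_def Let_def by (simp add: assms(1,2))
  have Stilde: "Stilde \<eta> xs ys f g = mat L2 L2 (\<lambda>(i, k).
      f (ys ! i) * X xs (ys ! i + \<eta>) * column_factor k (varsig (ys ! i + \<eta> / 2))
      + f (- (ys ! i)) * X xs (ys ! i - \<eta>) * column_factor k (varsig (ys ! i - \<eta> / 2))
      + (if k = L2 - 1 then g (ys ! i) / X xs (ys ! i) else 0))"
  proof (rule eq_matI, goal_cases)
    case (1 i k)
    \<comment> \<open>As \<open>L1 < L2\<close>, the column carrying \<open>g\<close> is never one
      of the first \<open>L1\<close>.\<close>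
    then have "k < L1 \<Longrightarrow> k \<noteq> L2 - 1"
      using assms(3) by auto
    with 1 show ?case
      by (simp add: Stilde_def Let_def column_factor_def assms(1,2) c_lower c_upper)
  qed (simp_all add: Stilde_def Let_def assms(2))
  have "reversal_sign L1 * vandermonde (\<lambda>k. c (L1 + k)) L1 * det M =
      vandermonde c L1 * (\<Prod>i<L2. X xs (ys ! i)) * det (Stilde \<eta> xs ys f g)"
    unfolding M_def Stilde
    by (rule det_reduction[of "\<lambda>i. varsig (?z i + \<eta> / 2)" "\<lambda>i. varsig (?z i - \<eta> / 2)"
          "\<lambda>i. f (- ?z i)" "\<lambda>i. f (?z i)" "\<lambda>i. g (?z i)" "\<lambda>i. X xs (ys ! i)"
          "\<lambda>i. X xs (ys ! i + \<eta>)" "\<lambda>i. X xs (ys ! i - \<eta>)", unfolded z_upper])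
      (use nz phi gamma off assms(2,12) in \<open>auto simp: z_lower c_lower c_upper node_plus node_minus mult.assoc\<close>)
  moreover have "vandermonde c L1 = Vhat (map (\<lambda>x. x - \<eta> / 2) xs)"
    unfolding Vhat_map vandermonde_def by (simp add: c_lower assms(1))
  moreover have "(\<Prod>i<L2. X xs (ys ! i)) \<noteq> 0"
    using assms(2,12) by auto
  moreover have "Vhat xs \<noteq> 0"
    using assms(6) by (auto simp: Vhat_rev)
  \<comment> \<open>\<open>Vhat (xs @ ys)\<close> contains the product of the row scalars, and
    \<open>Vhat (rev xs)\<close> absorbs the reversal sign.\<close>
  ultimately show ?thesis
    using assms(5,7) reversal_sign_nonzero[of L1, where 'a = complex]
    by (simp add: calA Vhat_append Vhat_rev upper_vandermonde assms(1,2) divide_simps) (simp add: mult_ac)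
qed

end
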